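(* Let $\mathscr{I}^{\nearrow}_{\infty}(\mathbb{Z})$ be the monoid of all injective monotone partial selfmaps of $\mathbb{Z}$ with cofinite domain and cofinite range. Every Baire topology $\tau$ on $\mathscr{I}^{\nearrow}_{\infty}(\mathbb{Z})$ such that $(\mathscr{I}^{\nearrow}_{\infty}(\mathbb{Z}),\tau)$ is a Hausdorff semitopological semigroup is discrete.
   Context: A partial map $\alpha\colon\mathbb{Z}\rightharpoonup\mathbb{Z}$ is monotone if $n\leqslant m$ implies $(n)\alpha\leqslant(m)\alpha$ for $n,m\in\operatorname{dom}\alpha$. $\mathscr{I}^{\nearrow}_{\infty}(\mathbb{Z})$ is the set of all injective monotone partial maps $\alpha\colon\mathbb{Z}\rightharpoonup\mathbb{Z}$ with $|\mathbb{Z}\setminus\operatorname{dom}\alpha|<\infty$ and $|\mathbb{Z}\setminus\operatorname{ran}\alpha|<\infty$, with composition $x(\alpha\beta)=(x\alpha)\beta$ for $x\in\operatorname{dom}(\alpha\beta)=\{y\in\operatorname{dom}\alpha\mid y\alpha\in\operatorname{dom}\beta\}$ (maps are written on the right). A semitopological semigroup is a Hausdorff topological space with a separately continuous semigroup operation. A topology on $X$ is Baire if for each sequence $A_1,A_2,\ldots$ of nowhere dense subsets of $X$ the complement of $\bigcup_{i=1}^\infty A_i$ is dense in $X$. *)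

theory Defs
  imports "HOL-Analysis.Analysis"
begin

definition IZ :: "(int \<rightharpoonup> int) set" where
  "IZ = {\<alpha>. inj_on \<alpha> (dom \<alpha>) \<and>
            monotone_on (dom \<alpha>) (\<le>) (\<le>) (\<lambda>n. the (\<alpha> n)) \<and>
            finite (UNIV - dom \<alpha>) \<and> finite (UNIV - ran \<alpha>)}"

text \<open>Maps are written on the right, so the product \<open>\<alpha>\<beta>\<close> applies \<open>\<alpha>\<close> first,
  whereas \<open>\<circ>\<^sub>m\<close> applies its right argument first.\<close>

definition IZ_mult :: "(int \<rightharpoonup> int) \<Rightarrow> (int \<rightharpoonup> int) \<Rightarrow> (int \<rightharpoonup> int)"
  where "IZ_mult \<alpha> \<beta> = \<beta> \<circ>\<^sub>m \<alpha>"

lemma dom_IZ_mult: "dom (IZ_mult \<alpha> \<beta>) = {y \<in> dom \<alpha>. the (\<alpha> y) \<in> dom \<beta>}"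
  by (auto simp: IZ_mult_def map_comp_def dom_def split: option.splits)

lemma the_IZ_mult: "x \<in> dom (IZ_mult \<alpha> \<beta>) \<Longrightarrow> the (IZ_mult \<alpha> \<beta> x) = the (\<beta> (the (\<alpha> x)))"
  by (auto simp: IZ_mult_def map_comp_def dom_def split: option.splits)

lemma IZ_one: "Some \<in> IZ"
  by (auto simp: IZ_def monotone_on_def dom_def ran_def)

lemma IZ_mult_one: "IZ_mult Some \<alpha> = \<alpha>" "IZ_mult \<alpha> Some = \<alpha>"
  by (auto simp: IZ_mult_def map_comp_def split: option.splits)

lemma IZ_mult_assoc: "IZ_mult (IZ_mult \<alpha> \<beta>) \<gamma> = IZ_mult \<alpha> (IZ_mult \<beta> \<gamma>)"
  by (auto simp: IZ_mult_def map_comp_def split: option.splits)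

lemma IZ_mult_closed:
  assumes a: "\<alpha> \<in> IZ" and b: "\<beta> \<in> IZ"
  shows "IZ_mult \<alpha> \<beta> \<in> IZ"
proof -
  have inja: "inj_on \<alpha> (dom \<alpha>)" and injb: "inj_on \<beta> (dom \<beta>)"
    and fin: "finite (UNIV - dom \<alpha>)" "finite (UNIV - dom \<beta>)"
      "finite (UNIV - ran \<alpha>)" "finite (UNIV - ran \<beta>)"
    using a b by (auto simp: IZ_def)
  have "inj_on (IZ_mult \<alpha> \<beta>) (dom (IZ_mult \<alpha> \<beta>))"
  proof (rule inj_onI)
    fix x y
    assume "x \<in> dom (IZ_mult \<alpha> \<beta>)" "y \<in> dom (IZ_mult \<alpha> \<beta>)"
      and eq: "IZ_mult \<alpha> \<beta> x = IZ_mult \<alpha> \<beta> y"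
    then obtain u v where uv: "\<alpha> x = Some u" "\<alpha> y = Some v" "u \<in> dom \<beta>" "v \<in> dom \<beta>"
      unfolding dom_IZ_mult by (metis (no_types, lifting) domD mem_Collect_eq option.sel)
    with eq injb have "u = v"
      by (auto simp: IZ_mult_def map_comp_def dest: inj_onD)
    with uv inja show "x = y"
      by (metis domI inj_onD)
  qed
  moreover have "monotone_on (dom (IZ_mult \<alpha> \<beta>)) (\<le>) (\<le>) (\<lambda>n. the (IZ_mult \<alpha> \<beta> n))"
    using a b unfolding monotone_on_def IZ_def by (auto simp: the_IZ_mult dom_IZ_mult)
  moreover have "finite (UNIV - dom (IZ_mult \<alpha> \<beta>))"
  proof (rule finite_subset)
    show "UNIV - dom (IZ_mult \<alpha> \<beta>)
      \<subseteq> (UNIV - dom \<alpha>) \<union> (\<alpha> -` (Some ` (UNIV - dom \<beta>)) \<inter> dom \<alpha>)"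
    proof
      fix x
      assume x: "x \<in> UNIV - dom (IZ_mult \<alpha> \<beta>)"
      show "x \<in> (UNIV - dom \<alpha>) \<union> (\<alpha> -` (Some ` (UNIV - dom \<beta>)) \<inter> dom \<alpha>)"
      proof (cases "\<alpha> x")
        case (Some y)
        with x have "y \<notin> dom \<beta>" by (auto simp: IZ_mult_def)
        with Some show ?thesis by blast
      qed auto
    qed
    show "finite ((UNIV - dom \<alpha>) \<union> (\<alpha> -` (Some ` (UNIV - dom \<beta>)) \<inter> dom \<alpha>))"
      using fin by (auto intro!: finite_vimage_IntI inja)
  qed
  moreover have "finite (UNIV - ran (IZ_mult \<alpha> \<beta>))"
  proof (rule finite_subset)
    show "UNIV - ran (IZ_mult \<alpha> \<beta>) \<subseteq> (UNIV - ran \<beta>) \<union> (\<lambda>y. the (\<beta> y)) ` (UNIV - ran \<alpha>)"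
    proof
      fix z
      assume z: "z \<in> UNIV - ran (IZ_mult \<alpha> \<beta>)"
      show "z \<in> (UNIV - ran \<beta>) \<union> (\<lambda>y. the (\<beta> y)) ` (UNIV - ran \<alpha>)"
      proof (cases "z \<in> ran \<beta>")
        case True
        then obtain y where y: "\<beta> y = Some z"
          by (auto simp: ran_def)
        have "y \<notin> ran \<alpha>"
        proof
          assume "y \<in> ran \<alpha>"
          then obtain x where "\<alpha> x = Some y" by (auto simp: ran_def)
          with y have "IZ_mult \<alpha> \<beta> x = Some z" by (simp add: IZ_mult_def)
          with z show False by (auto simp: ran_def)
        qed
        with y show ?thesis by force
      qed auto
    qed
    show "finite ((UNIV - ran \<beta>) \<union> (\<lambda>y. the (\<beta> y)) ` (UNIV - ran \<alpha>))"
      using fin by simp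
  qed
  ultimately show ?thesis by (simp add: IZ_def)
qed

definition semitopological_semigroup :: "('a \<Rightarrow> 'a \<Rightarrow> 'a) \<Rightarrow> 'a topology \<Rightarrow> bool" where
  "semitopological_semigroup f T \<longleftrightarrow>
     Hausdorff_space T \<and>
     (\<forall>x\<in>topspace T. \<forall>y\<in>topspace T. f x y \<in> topspace T) \<and>
     (\<forall>x\<in>topspace T. \<forall>y\<in>topspace T. \<forall>z\<in>topspace T. f (f x y) z = f x (f y z)) \<and>
     (\<forall>a\<in>topspace T. continuous_map T T (\<lambda>x. f a x) \<and> continuous_map T T (\<lambda>x. f x a))"

definition nowhere_dense_in :: "'a topology \<Rightarrow> 'a set \<Rightarrow> bool" where
  "nowhere_dense_in T A \<longleftrightarrow> A \<subseteq> topspace T \<and> T interior_of (T closure_of A) = {}"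

definition Baire_topology :: "'a topology \<Rightarrow> bool" where
  "Baire_topology T \<longleftrightarrow>
     (\<forall>A :: nat \<Rightarrow> 'a set. (\<forall>i. nowhere_dense_in T (A i)) \<longrightarrow>
        T closure_of (topspace T - (\<Union>i. A i)) = topspace T)"

end

theory Submission
  imports Defs
begin

text \<open>Any two cofinite subsets of \<open>\<int>\<close> are order isomorphic, and the order automorphisms of \<open>\<int>\<close> are
  the translations. Hence the monoid is countable, so a Baire \<open>T\<^sub>1\<close> topology on it has an
  isolated point \<open>\<alpha>\<close>. Moreover, every \<open>\<beta>\<close> satisfies \<open>\<gamma>\<beta>\<delta> = \<alpha>\<close> for some
  \<open>\<gamma>\<close>, \<open>\<delta>\<close> with \<open>dom \<gamma> = dom \<alpha>\<close>, \<open>ran \<gamma> = dom \<beta>\<close> and \<open>dom \<delta> = ran \<beta>\<close>. The solutions \<open>x\<close> of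
  \<open>\<gamma>x\<delta> = \<alpha>\<close> then all extend \<open>\<beta>\<close>; by injectivity and cofiniteness there are only
  finitely many of them. They form an open set by separate continuity, so \<open>\<beta>\<close> is isolated.\<close>

section \<open>Inverses and the order characterization of \<open>IZ\<close>\<close>

definition map_inverse :: "('a \<rightharpoonup> 'b) \<Rightarrow> ('b \<rightharpoonup> 'a)" where
  "map_inverse \<alpha> y = (if y \<in> ran \<alpha> then Some (THE x. \<alpha> x = Some y) else None)"

text \<open>Injectivity leaves the description in \<open>map_inverse\<close> a single candidate; the
  later proofs reason through this equivalence and never unfold \<open>THE\<close>.\<close>

lemma map_inverse_Some_iff:
  assumes "inj_on \<alpha> (dom \<alpha>)"
  shows "map_inverse \<alpha> y = Some x \<longleftrightarrow> \<alpha> x = Some y"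
proof -
  have "(THE x. \<alpha> x = Some y) = x" if "\<alpha> x = Some y" for x
    using that by (rule the_equality) (metis assms domI inj_onD that)
  then show ?thesis
    by (auto simp: map_inverse_def ran_def)
qed

lemma dom_map_inverse: "dom (map_inverse \<alpha>) = ran \<alpha>"
  by (auto simp: map_inverse_def dom_def)

lemma ran_map_inverse:
  assumes "inj_on \<alpha> (dom \<alpha>)"
  shows "ran (map_inverse \<alpha>) = dom \<alpha>"
  using map_inverse_Some_iff[OF assms] by (auto simp: ran_def dom_def)

lemma IZ_mult_Some_iff: "IZ_mult \<alpha> \<beta> x = Some z \<longleftrightarrow> (\<exists>y. \<alpha> x = Some y \<and> \<beta> y = Some z)"
  by (auto simp: IZ_mult_def map_comp_Some_iff)

lemma IZ_inj: "\<alpha> \<in> IZ \<Longrightarrow> inj_on \<alpha> (dom \<alpha>)"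
  by (simp add: IZ_def)

lemma IZ_eqD: "\<alpha> \<in> IZ \<Longrightarrow> \<alpha> x = Some z \<Longrightarrow> \<alpha> y = Some z \<Longrightarrow> x = y"
  using IZ_inj by (metis domI inj_onD)

lemma map_inverse_IZ_Some_iff: "\<alpha> \<in> IZ \<Longrightarrow> map_inverse \<alpha> y = Some x \<longleftrightarrow> \<alpha> x = Some y"
  by (rule map_inverse_Some_iff[OF IZ_inj])

text \<open>Injectivity makes monotonicity strict, and since the order of the integers is total, the
  order is reflected as well as preserved.\<close>

lemma IZ_le_iff:
  assumes "\<alpha> \<in> IZ" "\<alpha> x = Some u" "\<alpha> y = Some v"
  shows "u \<le> v \<longleftrightarrow> x \<le> y"
proof -
  have mono: "the (\<alpha> x) \<le> the (\<alpha> y)" if "x \<in> dom \<alpha>" "y \<in> dom \<alpha>" "x \<le> y" for x y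
    using assms(1) that by (auto simp: IZ_def monotone_on_def)
  show ?thesis
    using mono[of x y] mono[of y x] assms IZ_eqD[OF assms(1), of x u y] by fastforce
qed

text \<open>The order equivalence yields monotonicity directly and injectivity by antisymmetry, so
  membership reduces to it and two finiteness conditions.\<close>

lemma IZI:
  assumes "\<And>x y u v. \<alpha> x = Some u \<Longrightarrow> \<alpha> y = Some v \<Longrightarrow> u \<le> v \<longleftrightarrow> x \<le> y"
    and "finite (- dom \<alpha>)" "finite (- ran \<alpha>)"
  shows "\<alpha> \<in> IZ"
proof -
  have "inj_on \<alpha> (dom \<alpha>)"
  proof (rule inj_onI)
    fix x y assume "x \<in> dom \<alpha>" "\<alpha> x = \<alpha> y"
    then obtain u where "\<alpha> x = Some u" "\<alpha> y = Some u" by (metis domD)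
    then show "x = y" using assms(1) by (metis order_antisym order_refl)
  qed
  then show ?thesis
    using assms by (auto simp: IZ_def monotone_on_def Compl_eq_Diff_UNIV)
qed

lemma map_inverse_IZ:
  assumes "\<alpha> \<in> IZ"
  shows "map_inverse \<alpha> \<in> IZ"
proof (rule IZI)
  show "finite (- dom (map_inverse \<alpha>))" "finite (- ran (map_inverse \<alpha>))"
    using assms by (auto simp: IZ_def dom_map_inverse ran_map_inverse Compl_eq_Diff_UNIV)
qed (use assms IZ_le_iff map_inverse_IZ_Some_iff in blast)

section \<open>Order isomorphisms between cofinite subsets of the integers\<close>

lemma IZ_collapse_point:
  obtains \<sigma> where "\<sigma> \<in> IZ" "dom \<sigma> = - {b}" "ran \<sigma> = UNIV"
proof -
  \<comment> \<open>Everything above \<open>b\<close> moves down by one, closing the gap at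
    \<open>b\<close>.\<close>
  define \<sigma> where "\<sigma> n = (if n < b then Some n else if n = b then None else Some (n - 1))" for n
  have dom: "dom \<sigma> = - {b}"
    by (auto simp: \<sigma>_def dom_def)
  \<comment> \<open>The value \<open>b\<close> itself already comes from \<open>b + 1\<close>, hence
    the strict inequality.\<close>
  have "\<sigma> (if y < b then y else y + 1) = Some y" for y
    by (auto simp: \<sigma>_def)
  then have ran: "ran \<sigma> = UNIV"
    by (auto intro: ranI)
  have "\<sigma> \<in> IZ"
    by (rule IZI) (auto simp: dom ran, auto simp: \<sigma>_def split: if_splits)
  with dom ran show ?thesis
    using that by blast
qed

lemma IZ_collapse:
  assumes "finite F"
  shows "\<exists>\<phi>\<in>IZ. dom \<phi> = - F \<and> ran \<phi> = UNIV"
  using assms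
proof (induction F)
  case empty
  show ?case by (rule bexI[OF _ IZ_one]) (auto simp: ran_def)
next
  case (insert a F)
  then obtain \<phi> where \<phi>: "\<phi> \<in> IZ" "dom \<phi> = - F" "ran \<phi> = UNIV" by blast
  with insert obtain b where b: "\<phi> a = Some b" by blast
  \<comment> \<open>After \<open>F\<close> has been collapsed, \<open>a\<close> sits at position
    \<open>b\<close>, so \<open>b\<close> is the point to remove next.\<close>
  obtain \<sigma> where \<sigma>: "\<sigma> \<in> IZ" "dom \<sigma> = - {b}" "ran \<sigma> = UNIV"
    using IZ_collapse_point by blast
  have "dom (IZ_mult \<phi> \<sigma>) = - insert a F"
  proof (rule set_eqI)
    fix x
    have "x \<in> dom \<phi> \<and> the (\<phi> x) \<noteq> b \<longleftrightarrow> x \<in> dom \<phi> \<and> x \<noteq> a"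
      using b IZ_eqD[OF \<phi>(1) _ b] by (metis domD option.sel)
    then show "x \<in> dom (IZ_mult \<phi> \<sigma>) \<longleftrightarrow> x \<in> - insert a F"
      by (auto simp: dom_IZ_mult \<phi> \<sigma>)
  qed
  moreover have "z \<in> ran (IZ_mult \<phi> \<sigma>)" for z
  proof -
    obtain y where "\<sigma> y = Some z" using \<sigma>(3) by (auto simp: ran_def)
    moreover obtain x where "\<phi> x = Some y" using \<phi>(3) by (auto simp: ran_def)
    ultimately show ?thesis by (auto simp: ran_def IZ_mult_Some_iff)
  qed
  ultimately show ?case
    using IZ_mult_closed \<phi>(1) \<sigma>(1) by blast
qed

section \<open>Translations and countability\<close>

lemma IZ_automorphism_shift:
  assumes "\<kappa> \<in> IZ" "dom \<kappa> = UNIV" "ran \<kappa> = UNIV"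
  shows "\<exists>k. \<kappa> = (\<lambda>n. Some (k + n))"
proof -
  define f where "f n = the (\<kappa> n)" for n
  have \<kappa>: "\<kappa> n = Some (f n)" for n
    using assms(2) unfolding f_def by (metis UNIV_I domD option.sel)
  have le: "f m \<le> f n \<longleftrightarrow> m \<le> n" for m n
    using IZ_le_iff[OF assms(1) \<kappa> \<kappa>] .
  have step: "f (n + 1) = f n + 1" for n
  proof -
    \<comment> \<open>The preimage \<open>m\<close> of the successor of \<open>f n\<close> lies
      above \<open>n\<close>, so \<open>n + 1 \<le> m\<close>; this squeezes
      \<open>f (n + 1)\<close> between \<open>f n\<close> and \<open>f n + 1\<close>.\<close>
    obtain m where m: "f m = f n + 1"
      using assms(3) \<kappa> by (auto simp: ran_def)
    have "\<not> m \<le> n" using le[of m n] m by simp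
    then have "f (n + 1) \<le> f m" by (simp add: le)
    moreover have "\<not> f (n + 1) \<le> f n" by (simp add: le)
    ultimately show ?thesis using m by simp
  qed
  have "f n = f 0 + n" for n
  proof (induction n rule: int_induct[where k = 0])
    case (step1 i)
    then show ?case using step[of i] by simp
  next
    case (step2 i)
    then show ?case using step[of "i - 1"] by simp
  qed simp
  then have "\<kappa> = (\<lambda>n. Some (f 0 + n))"
    by (intro ext) (metis \<kappa>)
  then show ?thesis by blast
qed

text \<open>Both domains collapse onto all integers; collapsing the first and then expanding along
  the inverse of the second gives \<open>\<gamma>\<close>.\<close>

lemma IZ_dom_transport:
  assumes "\<alpha> \<in> IZ" "\<beta> \<in> IZ"
  shows "\<exists>\<gamma>\<in>IZ. dom \<gamma> = dom \<alpha> \<and> ran \<gamma> = dom \<beta>"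
proof -
  have "finite (- dom \<alpha>)" "finite (- dom \<beta>)"
    using assms by (auto simp: IZ_def Compl_eq_Diff_UNIV)
  from this[THEN IZ_collapse] obtain \<phi> \<psi>
    where \<phi>: "\<phi> \<in> IZ" "dom \<phi> = dom \<alpha>" "ran \<phi> = UNIV"
      and \<psi>: "\<psi> \<in> IZ" "dom \<psi> = dom \<beta>" "ran \<psi> = UNIV"
    by auto
  let ?\<gamma> = "IZ_mult \<phi> (map_inverse \<psi>)"
  have "?\<gamma> x = Some z \<longleftrightarrow> (\<exists>y. \<phi> x = Some y \<and> \<psi> z = Some y)" for x z
    by (simp add: IZ_mult_Some_iff map_inverse_IZ_Some_iff \<psi>)
  moreover have "\<exists>x. \<phi> x = Some y" "\<exists>z. \<psi> z = Some y" for y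
    using \<phi>(3) \<psi>(3) by (auto simp: ran_def)
  ultimately have "dom ?\<gamma> = dom \<phi>" "ran ?\<gamma> = dom \<psi>"
    unfolding dom_def ran_def by fastforce+
  then show ?thesis
    using \<phi> \<psi> IZ_mult_closed map_inverse_IZ by metis
qed

text \<open>With one collapse fixed for each finite set, every element is encoded by the complements
  \<open>F\<close>, \<open>G\<close> of its domain and range and a translation amount
  \<open>k\<close>; \<open>g\<close> decodes such triples.\<close>

lemma countable_IZ: "countable IZ"
proof -
  obtain \<phi> where \<phi>: "\<And>F. finite F \<Longrightarrow> \<phi> F \<in> IZ \<and> dom (\<phi> F) = - F \<and> ran (\<phi> F) = UNIV"
    using IZ_collapse by metis
  define g where "g = (\<lambda>(F, G, k).
    IZ_mult (\<phi> F) (IZ_mult (\<lambda>n. Some (k + n)) (map_inverse (\<phi> G))))"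
  have "IZ \<subseteq> g ` (Fpow UNIV \<times> Fpow UNIV \<times> UNIV)"
  proof
    fix \<alpha> assume \<alpha>: "\<alpha> \<in> IZ"
    define F where "F = - dom \<alpha>"
    define G where "G = - ran \<alpha>"
    have fin: "finite F" "finite G"
      using \<alpha> by (auto simp: IZ_def F_def G_def Compl_eq_Diff_UNIV)
    have F: "\<phi> F \<in> IZ" "dom (\<phi> F) = dom \<alpha>" "ran (\<phi> F) = UNIV"
      and G: "\<phi> G \<in> IZ" "dom (\<phi> G) = ran \<alpha>" "ran (\<phi> G) = UNIV"
      using \<phi> fin by (auto simp: F_def G_def)
    \<comment> \<open>This is \<open>\<alpha>\<close> read in collapsed coordinates on both sides,
      where it becomes an order automorphism of the integers.\<close>
    let ?\<kappa> = "IZ_mult (map_inverse (\<phi> F)) (IZ_mult \<alpha> (\<phi> G))"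
    have \<kappa>: "?\<kappa> p = Some q \<longleftrightarrow> (\<exists>x y. \<phi> F x = Some p \<and> \<alpha> x = Some y \<and> \<phi> G y = Some q)" for p q
      by (auto simp: IZ_mult_Some_iff map_inverse_IZ_Some_iff F)
    have "\<exists>q. ?\<kappa> p = Some q" for p
    proof -
      obtain x where x: "\<phi> F x = Some p" using F(3) by (auto simp: ran_def)
      then obtain y where y: "\<alpha> x = Some y" using F(2) by blast
      then obtain q where "\<phi> G y = Some q" using G(2) ranI by (metis domD)
      with x y show ?thesis using \<kappa> by blast
    qed
    then have "dom ?\<kappa> = UNIV" by blast
    moreover have "\<exists>p. ?\<kappa> p = Some q" for q
    proof -
      obtain y where y: "\<phi> G y = Some q" using G(3) by (auto simp: ran_def)
      then have "y \<in> ran \<alpha>" using G(2) by blast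
      then obtain x where x: "\<alpha> x = Some y" by (auto simp: ran_def)
      then obtain p where "\<phi> F x = Some p" using F(2) by blast
      with x y show ?thesis using \<kappa> by blast
    qed
    then have "ran ?\<kappa> = UNIV" by (auto simp: ran_def)
    ultimately obtain k where k: "?\<kappa> = (\<lambda>n. Some (k + n))"
      using IZ_automorphism_shift IZ_mult_closed map_inverse_IZ F(1) G(1) \<alpha> by meson
    have g: "g (F, G, k) x = Some z \<longleftrightarrow>
        (\<exists>p q. \<phi> F x = Some p \<and> ?\<kappa> p = Some q \<and> \<phi> G z = Some q)" for x z
      unfolding g_def prod.case k[symmetric]
      by (subst IZ_mult_Some_iff, subst IZ_mult_Some_iff) (auto simp: map_inverse_IZ_Some_iff G)
    have "g (F, G, k) x = Some z \<longleftrightarrow> \<alpha> x = Some z" for x z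
    proof
      assume "g (F, G, k) x = Some z"
      then show "\<alpha> x = Some z"
        unfolding g \<kappa> using IZ_eqD F(1) G(1) by metis
    next
      assume a: "\<alpha> x = Some z"
      then obtain p where "\<phi> F x = Some p" using F(2) by blast
      moreover obtain q where "\<phi> G z = Some q" using a G(2) ranI by (metis domD)
      ultimately show "g (F, G, k) x = Some z"
        unfolding g \<kappa> using a by blast
    qed
    then have "\<alpha> = g (F, G, k)"
      by (metis (no_types, lifting) ext not_Some_eq)
    then show "\<alpha> \<in> g ` (Fpow UNIV \<times> Fpow UNIV \<times> UNIV)"
      using fin by (auto simp: Fpow_def)
  qed
  moreover have "countable (g ` (Fpow UNIV \<times> Fpow UNIV \<times> UNIV))"
    by (intro countable_image countable_SIGMA countable_Fpow countableI_type)
  ultimately show ?thesis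
    by (rule countable_subset)
qed

section \<open>Finiteness of extensions and of solution sets\<close>

lemma finite_IZ_extensions:
  assumes "\<beta> \<in> IZ"
  shows "finite {x \<in> IZ. \<beta> \<subseteq>\<^sub>m x}"
proof -
  let ?E = "Map.graph \<beta> \<union> (- dom \<beta>) \<times> (- ran \<beta>)"
  have "Map.graph x \<in> (\<lambda>s. Map.graph \<beta> \<union> s) ` Pow ((- dom \<beta>) \<times> (- ran \<beta>))"
    if x: "x \<in> IZ" and ext: "\<beta> \<subseteq>\<^sub>m x" for x
  proof -
    have ext': "x n = Some m" if "\<beta> n = Some m" for n m
      using ext that by (metis domI map_le_def)
    \<comment> \<open>A new pair can reuse no argument of \<open>\<beta>\<close>, as
      \<open>x\<close> is single-valued, and no value of \<open>\<beta>\<close>, as \<open>x\<close>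
      is injective.\<close>
    have "n \<notin> dom \<beta> \<and> m \<notin> ran \<beta>" if "x n = Some m" "\<beta> n \<noteq> Some m" for n m
      using that ext' IZ_eqD[OF x] by (fastforce simp: ran_def)
    then have "Map.graph x - Map.graph \<beta> \<subseteq> (- dom \<beta>) \<times> (- ran \<beta>)"
      by (auto simp: Map.graph_def)
    moreover have "Map.graph x = Map.graph \<beta> \<union> (Map.graph x - Map.graph \<beta>)"
      using ext' by (auto simp: Map.graph_def)
    ultimately show ?thesis by blast
  qed
  then have "Map.graph ` {x \<in> IZ. \<beta> \<subseteq>\<^sub>m x}
      \<subseteq> (\<lambda>s. Map.graph \<beta> \<union> s) ` Pow ((- dom \<beta>) \<times> (- ran \<beta>))"
    by blast
  moreover have "finite (- dom \<beta>)" "finite (- ran \<beta>)"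
    using assms by (auto simp: IZ_def Compl_eq_Diff_UNIV)
  then have "finite ((\<lambda>s. Map.graph \<beta> \<union> s) ` Pow ((- dom \<beta>) \<times> (- ran \<beta>)))"
    by blast
  ultimately have "finite (Map.graph ` {x \<in> IZ. \<beta> \<subseteq>\<^sub>m x})"
    by (rule finite_subset)
  moreover have "inj Map.graph"
  proof (rule injI, rule ext)
    fix x y :: "'a \<rightharpoonup> 'b" and n
    assume "Map.graph x = Map.graph y"
    then have "x n = Some m \<longleftrightarrow> y n = Some m" for m
      by (auto simp: Map.graph_def set_eq_iff)
    then show "x n = y n" by (metis not_Some_eq)
  qed
  ultimately show ?thesis
    using finite_imageD inj_on_subset by blast
qed

text \<open>The solution set is the fibre over \<open>\<alpha>\<close> of a two-sided translation;
  this is what carries isolation from \<open>\<alpha>\<close> to \<open>\<beta>\<close>.\<close>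

lemma IZ_finite_solution_set:
  assumes \<alpha>: "\<alpha> \<in> IZ" and \<beta>: "\<beta> \<in> IZ"
  shows "\<exists>\<gamma>\<in>IZ. \<exists>\<delta>\<in>IZ. IZ_mult (IZ_mult \<gamma> \<beta>) \<delta> = \<alpha> \<and>
    finite {x \<in> IZ. IZ_mult (IZ_mult \<gamma> x) \<delta> = \<alpha>}"
proof -
  obtain \<gamma> where \<gamma>: "\<gamma> \<in> IZ" "dom \<gamma> = dom \<alpha>" "ran \<gamma> = dom \<beta>"
    using IZ_dom_transport[OF \<alpha> \<beta>] by blast
  \<comment> \<open>Solving \<open>\<gamma>\<beta>\<delta> = \<alpha>\<close> for
    \<open>\<delta>\<close> by partial inverses.\<close>
  define \<delta> where "\<delta> = IZ_mult (map_inverse \<beta>) (IZ_mult (map_inverse \<gamma>) \<alpha>)"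
  have \<delta>IZ: "\<delta> \<in> IZ"
    unfolding \<delta>_def by (intro IZ_mult_closed map_inverse_IZ \<alpha> \<beta> \<gamma>)
  have \<delta>: "\<delta> k = Some l \<longleftrightarrow> (\<exists>m n. \<beta> m = Some k \<and> \<gamma> n = Some m \<and> \<alpha> n = Some l)" for k l
    unfolding \<delta>_def by (auto simp: IZ_mult_Some_iff map_inverse_IZ_Some_iff \<beta> \<gamma>)
  have "IZ_mult (IZ_mult \<gamma> \<beta>) \<delta> n = Some l \<longleftrightarrow> \<alpha> n = Some l" for n l
  proof
    assume "IZ_mult (IZ_mult \<gamma> \<beta>) \<delta> n = Some l"
    then show "\<alpha> n = Some l"
      unfolding IZ_mult_Some_iff \<delta> using IZ_eqD \<beta> \<gamma>(1) by metis
  next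
    assume a: "\<alpha> n = Some l"
    then obtain m where m: "\<gamma> n = Some m" using \<gamma>(2) by blast
    then obtain k where "\<beta> m = Some k" using \<gamma>(3) ranI by (metis domD)
    then show "IZ_mult (IZ_mult \<gamma> \<beta>) \<delta> n = Some l"
      unfolding IZ_mult_Some_iff \<delta> using a m by blast
  qed
  then have eq: "IZ_mult (IZ_mult \<gamma> \<beta>) \<delta> = \<alpha>"
    by (metis (no_types, lifting) ext not_Some_eq)
  \<comment> \<open>Each \<open>m\<close> in \<open>dom \<beta>\<close> is some value of
    \<open>\<gamma>\<close>, so \<open>\<delta>\<close> sends the images of \<open>m\<close> under
    \<open>\<beta>\<close> and under \<open>x\<close> to the same integer; injectivity of
    \<open>\<delta>\<close> identifies them.\<close>
  have "\<beta> \<subseteq>\<^sub>m x" if x: "IZ_mult (IZ_mult \<gamma> x) \<delta> = \<alpha>" for x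
    unfolding map_le_def
  proof
    fix m assume "m \<in> dom \<beta>"
    then obtain n where n: "\<gamma> n = Some m" using \<gamma>(3) by (auto simp: ran_def)
    then obtain l where l: "\<alpha> n = Some l" using \<gamma>(2) by blast
    obtain k where k: "\<beta> m = Some k" "\<delta> k = Some l"
      using l n unfolding eq[symmetric] IZ_mult_Some_iff by auto
    obtain k' where k': "x m = Some k'" "\<delta> k' = Some l"
      using l n unfolding x[symmetric] IZ_mult_Some_iff by auto
    show "\<beta> m = x m"
      using k k' IZ_eqD[OF \<delta>IZ] by metis
  qed
  then have "{x \<in> IZ. IZ_mult (IZ_mult \<gamma> x) \<delta> = \<alpha>} \<subseteq> {x \<in> IZ. \<beta> \<subseteq>\<^sub>m x}"
    by blast
  with finite_IZ_extensions[OF \<beta>] eq \<gamma>(1) \<delta>IZ show ?thesis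
    using finite_subset by blast
qed

section \<open>Isolated points\<close>

lemma Baire_countable_isolated_point:
  assumes "Baire_topology T" "t1_space T" "countable (topspace T)" "topspace T \<noteq> {}"
  shows "\<exists>x\<in>topspace T. openin T {x}"
proof (rule ccontr)
  assume not_open: "\<not> (\<exists>x\<in>topspace T. openin T {x})"
  have "nowhere_dense_in T {x}" if x: "x \<in> topspace T" for x
  proof -
    have "T closure_of {x} = {x}"
      using assms(2) x by (simp add: closure_of_eq t1_space_closedin_singleton)
    moreover have "T interior_of {x} = {}"
      using not_open x openin_interior_of[of T "{x}"] interior_of_subset[of T "{x}"]
      by (metis subset_singletonD)
    ultimately show ?thesis
      using x by (simp add: nowhere_dense_in_def)
  qed
  \<comment> \<open>An enumeration, possibly with repetitions, covers the space by a sequence of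
    nowhere dense singletons, so the complement that should be dense is empty.\<close>
  then have "\<forall>i. nowhere_dense_in T {from_nat_into (topspace T) i}"
    using from_nat_into[OF assms(4)] by blast
  then have "T closure_of (topspace T - (\<Union>i. {from_nat_into (topspace T) i})) = topspace T"
    using assms(1)[unfolded Baire_topology_def, rule_format,
        of "\<lambda>i. {from_nat_into (topspace T) i}"] by blast
  moreover have "(\<Union>i. {from_nat_into (topspace T) i}) = topspace T"
    using range_from_nat_into[OF assms(4,3)] by auto
  ultimately show False
    using assms(4) by simp
qed

text \<open>The other points of \<open>U\<close> form a finite, hence closed, set, and removing it
  from \<open>U\<close> leaves an open singleton.\<close>

lemma t1_finite_open_isolated:
  assumes "t1_space T" "openin T U" "finite U" "x \<in> U"
  shows "openin T {x}"
proof -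
  have "closedin T (U - {x})"
    using assms openin_subset[OF assms(2)] by (auto simp: t1_space_closedin_finite)
  then have "openin T (U - (U - {x}))"
    using assms(2) by (rule openin_diff[rotated])
  moreover have "U - (U - {x}) = {x}"
    using assms(4) by blast
  ultimately show ?thesis by simp
qed

theorem theorem4p1:
  fixes \<tau> :: "(int \<rightharpoonup> int) topology"
  assumes "topspace \<tau> = IZ"
    and "Baire_topology \<tau>"
    and "semitopological_semigroup IZ_mult \<tau>"
  shows "\<tau> = discrete_topology IZ"
proof -
  have t1: "t1_space \<tau>"
    using assms(3) by (simp add: semitopological_semigroup_def Hausdorff_imp_t1_space)
  have cont: "continuous_map \<tau> \<tau> (\<lambda>x. IZ_mult a x)" "continuous_map \<tau> \<tau> (\<lambda>x. IZ_mult x a)"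
    if "a \<in> IZ" for a
    using assms(1,3) that by (auto simp: semitopological_semigroup_def)
  obtain \<alpha> where \<alpha>: "\<alpha> \<in> IZ" "openin \<tau> {\<alpha>}"
    using Baire_countable_isolated_point[OF assms(2) t1] countable_IZ IZ_one assms(1) by auto
  have "openin \<tau> {\<beta>}" if \<beta>: "\<beta> \<in> IZ" for \<beta>
  proof -
    obtain \<gamma> \<delta> where *: "\<gamma> \<in> IZ" "\<delta> \<in> IZ" "IZ_mult (IZ_mult \<gamma> \<beta>) \<delta> = \<alpha>"
      "finite {x \<in> IZ. IZ_mult (IZ_mult \<gamma> x) \<delta> = \<alpha>}"
      using IZ_finite_solution_set[OF \<alpha>(1) \<beta>] by blast
    \<comment> \<open>A left translation followed by a right one: separate continuity suffices, and
      the fibre over the isolated \<open>\<alpha>\<close> is open.\<close>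
    have "continuous_map \<tau> \<tau> (\<lambda>x. IZ_mult (IZ_mult \<gamma> x) \<delta>)"
      using continuous_map_compose[OF cont(1)[OF *(1)] cont(2)[OF *(2)]] by (simp add: o_def)
    from openin_continuous_map_preimage[OF this \<alpha>(2)]
    have "openin \<tau> {x \<in> IZ. IZ_mult (IZ_mult \<gamma> x) \<delta> = \<alpha>}"
      by (simp add: assms(1))
    then show ?thesis
      using t1_finite_open_isolated[OF t1 _ *(4)] *(3) \<beta> by blast
  qed
  then show ?thesis
    using discrete_topology_unique[of IZ \<tau>] assms(1) by metis
qed

end
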